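(* Let $|q|<1$ and $x\in\mathbb{C}$. Then \[ 2\sum_{n\geq 0} \frac{(-1)^n\prod_{i=1}^n(1+2xq^{2i-1}+q^{4i-2})}{(q^4;q^4)_n} =\frac{(q^2;q^4)_\infty}{(q^4;q^4)_\infty}\sum_{n\geq 0}(-1)^n q^{n^2} \big(V_n(x)+V_{n-1}(x)\big). \]
   Context: $(a;q)_n=\prod_{k=0}^{n-1}(1-aq^k)$, $(a;q)_\infty=\prod_{k\ge0}(1-aq^k)$. $V_n(x)$ is the Chebyshev polynomial of the third kind: $V_0=1$, $V_1=2x-1$, $V_n=2xV_{n-1}-V_{n-2}$ ($n>1$), and $V_n=0$ for $n<0$.
   Formalization: The series on the left diverges in the ordinary sense (for q=0 it is 1−1+1−…), so its sum is taken as the Cesàro (C,1) sum, the limit of the averages of the partial sums; this agrees with the ordinary sum whenever the latter exists. *)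

theory Defs
  imports "HOL-Analysis.Analysis"
begin

definition qpoch :: "complex \<Rightarrow> complex \<Rightarrow> nat \<Rightarrow> complex" where
  "qpoch a q n = (\<Prod>k<n. 1 - a * q ^ k)"

definition qpoch_inf :: "complex \<Rightarrow> complex \<Rightarrow> complex" where
  "qpoch_inf a q = (\<Prod>k. 1 - a * q ^ k)"

fun chebyshev_V_nat :: "nat \<Rightarrow> complex \<Rightarrow> complex" where
  "chebyshev_V_nat 0 x = 1"
| "chebyshev_V_nat (Suc 0) x = 2 * x - 1"
| "chebyshev_V_nat (Suc (Suc n)) x = 2 * x * chebyshev_V_nat (Suc n) x - chebyshev_V_nat n x"

definition chebyshev_V :: "int \<Rightarrow> complex \<Rightarrow> complex" where
  "chebyshev_V n x = (if n < 0 then 0 else chebyshev_V_nat (nat n) x)"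

text \<open>
  Cesaro (C,1) summation: the limit of the arithmetic means of the partial sums.
  It is needed because the terms of the series
  \<open>\<Sum>n. (-1)^n (\<Prod>i=1..n. 1 + 2 x q^(2i-1) + q^(4i-2)) / (q^4;q^4)_n\<close>
  have the form \<open>(-1)^n c_n\<close>, where \<open>c_n\<close> converges to a limit that is nonzero in general, so
  that the series diverges in the ordinary sense (for \<open>q = 0\<close> it is \<open>1 - 1 + 1 - \<dots>\<close>).
  For an ordinarily convergent series the Cesaro sum is the usual sum.
\<close>

definition cesaro_sums :: "(nat \<Rightarrow> complex) \<Rightarrow> complex \<Rightarrow> bool" where
  "cesaro_sums f s \<longleftrightarrow> (\<lambda>N. (\<Sum>k<N. \<Sum>n\<le>k. f n) / of_nat N) \<longlonglongrightarrow> s"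

definition cesaro_summable :: "(nat \<Rightarrow> complex) \<Rightarrow> bool" where
  "cesaro_summable f \<longleftrightarrow> (\<exists>s. cesaro_sums f s)"

definition cesaro_suminf :: "(nat \<Rightarrow> complex) \<Rightarrow> complex" where
  "cesaro_suminf f = (THE s. cesaro_sums f s)"

end

theory Submission
  imports Defs
begin

text \<open>
  Put \<open>p = q\<^sup>2\<close> and \<open>x = (z + 1/z)/2\<close>. The left-hand series is
  \<open>\<^sub>2\<phi>\<^sub>1(-zq, -q/z; -p; p, -1)\<close>, the q-Gauss sum at the boundary of its domain of convergence.
  Replacing the lower parameter \<open>c\<close> by \<open>cp\<close> changes a q-Gauss sum by an explicit factor, because
  the difference of the two summands telescopes; only in the first step does the boundary term
  survive, and there it oscillates and has Cesaro mean 0. Iterating, twice the Cesaro sum is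
  \<open>\<Prod>(1 - 2xq^(2i-1) + q^(4i-2)) / (-p;p)\<^sub>\<infinity>\<^sup>2\<close>. By the Jacobi triple product, the limit of its finite form
  with q-binomial coefficients, the numerator is \<open>\<Sum>(-1)^n q^(n^2) (V_n + V_(n-1)) / (p;p)\<^sub>\<infinity>\<close>. Euler's
  identity \<open>(p;p\<^sup>2)\<^sub>\<infinity> (-p;p)\<^sub>\<infinity> = 1\<close> then turns the prefactor into the stated one.
\<close>

subsection \<open>Cesaro means\<close>

text \<open>The finitely many terms before \<open>M\<close> have norms summing to a fixed
  \<open>C\<close>, which division by \<open>N\<close> kills; the later terms contribute at most
  \<open>e / 2\<close> on average.\<close>

lemma tendsto_zero_imp_mean_tendsto_zero:
  fixes X :: "nat \<Rightarrow> complex"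
  assumes "X \<longlonglongrightarrow> 0"
  shows "(\<lambda>N. (\<Sum>k<N. X k) / of_nat N) \<longlonglongrightarrow> 0"
proof (rule LIMSEQ_I)
  fix e :: real assume e: "e > 0"
  obtain M where M: "\<And>k. k \<ge> M \<Longrightarrow> norm (X k) < e / 2"
    using LIMSEQ_D[OF assms, of "e / 2"] e by auto
  define C where "C = (\<Sum>k<M. norm (X k))"
  have C: "C \<ge> 0" by (simp add: C_def sum_nonneg)
  \<comment> \<open>\<open>K\<close> is chosen so that \<open>C < N * (e / 2)\<close> as soon as
    \<open>N\<close> exceeds \<open>K\<close>.\<close>
  obtain K :: nat where K: "2 * C / e < real K"
    using reals_Archimedean2 by blast
  have "norm ((\<Sum>k<N. X k) / of_nat N) < e" if N: "N \<ge> max (Suc M) (Suc K)" for N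
  proof -
    have "norm (\<Sum>k<N. X k) \<le> (\<Sum>k<N. norm (X k))"
      by (rule norm_sum)
    also have "(\<Sum>k<N. norm (X k)) = C + (\<Sum>k=M..<N. norm (X k))"
    proof -
      have "{..<N} = {..<M} \<union> {M..<N}" using N by auto
      then show ?thesis unfolding C_def
        by (simp add: sum.union_disjoint ivl_disj_int)
    qed
    also have "(\<Sum>k=M..<N. norm (X k)) \<le> (\<Sum>k=M..<N. e / 2)"
      using M by (intro sum_mono) (auto intro: less_imp_le)
    also have "(\<Sum>k=M..<N. e / 2) \<le> real N * (e / 2)"
      using e by (simp add: mult_right_mono)
    finally have 1: "norm (\<Sum>k<N. X k) \<le> C + real N * (e / 2)" by simp
    have "2 * C < real K * e" using K e by (simp add: field_simps)
    also have "\<dots> \<le> real N * e" using N e by (intro mult_right_mono) auto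
    finally have "norm (\<Sum>k<N. X k) < real N * e" using 1 by simp
    then show ?thesis using N by (simp add: norm_divide field_simps)
  qed
  then show "\<exists>no. \<forall>N\<ge>no. norm ((\<Sum>k<N. X k) / of_nat N - 0) < e"
    by (metis diff_zero)
qed

text \<open>The partial sums differ from \<open>a + (- 1) ^ k * b\<close> by a null sequence, and
  the sums of the alternating part stay in \<open>{0, b}\<close>, so their means vanish. The partial
  sums of the left-hand series have exactly this shape.\<close>

lemma cesaro_sumsI_oscillating:
  assumes eq: "\<And>k. (\<Sum>n\<le>k. f n) = A k + (- 1) ^ k * B k"
    and A: "A \<longlonglongrightarrow> a" and B: "B \<longlonglongrightarrow> b"
  shows "cesaro_sums f a"
proof -
  have 1: "(\<lambda>k. (A k - a) + (- 1) ^ k * (B k - b)) \<longlonglongrightarrow> 0"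
  proof -
    have "(\<lambda>k. (- 1) ^ k * (B k - b)) \<longlonglongrightarrow> 0"
      using tendsto_norm[OF LIM_zero[OF B]]
      by (subst tendsto_norm_zero_iff[symmetric]) (simp add: norm_mult norm_power)
    from tendsto_add[OF LIM_zero[OF A] this] show ?thesis by simp
  qed
  have alt: "norm (\<Sum>k<N. (- 1) ^ k * b) \<le> norm b" for N :: nat
  proof -
    have "(\<Sum>k<N. (- 1) ^ k * b) = (if even N then 0 else b)"
      by (induction N) auto
    then show ?thesis by simp
  qed
  have 2: "(\<lambda>N. (\<Sum>k<N. (- 1) ^ k * b) / of_nat N) \<longlonglongrightarrow> 0"
  proof (rule Lim_null_comparison)
    show "\<forall>\<^sub>F N in sequentially. norm ((\<Sum>k<N. (- 1) ^ k * b) / of_nat N) \<le> norm b / real N"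
      using alt by (intro always_eventually) (auto simp: norm_divide intro!: divide_right_mono)
    show "(\<lambda>N. norm b / real N) \<longlonglongrightarrow> 0"
      by (rule lim_const_over_n)
  qed
  have "(\<lambda>N. (\<Sum>k<N. (A k - a) + (- 1) ^ k * (B k - b)) / of_nat N
             + (\<Sum>k<N. (- 1) ^ k * b) / of_nat N + a) \<longlonglongrightarrow> a"
    using tendsto_add[OF tendsto_add[OF tendsto_zero_imp_mean_tendsto_zero[OF 1] 2] tendsto_const[of a]]
    by simp
  moreover have "\<forall>\<^sub>F N in sequentially.
      (\<Sum>k<N. (A k - a) + (- 1) ^ k * (B k - b)) / of_nat N
             + (\<Sum>k<N. (- 1) ^ k * b) / of_nat N + a = (\<Sum>k<N. \<Sum>n\<le>k. f n) / of_nat N"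
    using eventually_gt_at_top[of 0]
  proof eventually_elim
    case (elim N)
    have "(\<Sum>k<N. \<Sum>n\<le>k. f n)
        = (\<Sum>k<N. ((A k - a) + (- 1) ^ k * (B k - b)) + (- 1) ^ k * b + a)"
      unfolding eq by (intro sum.cong) (auto simp: algebra_simps)
    also have "\<dots> = (\<Sum>k<N. (A k - a) + (- 1) ^ k * (B k - b)) + (\<Sum>k<N. (- 1) ^ k * b)
        + of_nat N * a"
      unfolding sum.distrib by simp
    finally show ?case using elim by (simp add: add_divide_distrib)
  qed
  ultimately show ?thesis
    unfolding cesaro_sums_def by (rule Lim_transform_eventually)
qed

lemma cesaro_suminf_eqI: "cesaro_sums f s \<Longrightarrow> cesaro_suminf f = s"
  unfolding cesaro_suminf_def cesaro_sums_def
  by (rule the_equality) (auto intro: LIMSEQ_unique)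

subsection \<open>q-shifted factorials\<close>

lemma qpoch_0 [simp]: "qpoch a q 0 = 1"
  and qpoch_Suc: "qpoch a q (Suc n) = qpoch a q n * (1 - a * q ^ n)"
  by (simp_all add: qpoch_def)

lemma qpoch_eq_0_iff: "qpoch a q n = 0 \<longleftrightarrow> (\<exists>k<n. a * q ^ k = 1)"
  by (auto simp: qpoch_def)

lemma norm_mult_power_less_one:
  fixes a q :: complex
  assumes "norm a < 1" "norm q < 1"
  shows "norm (a * q ^ k) < 1"
proof -
  have "norm q ^ k \<le> 1" using assms by (intro power_le_one) auto
  then have "norm a * norm q ^ k \<le> norm a * 1" by (intro mult_left_mono) auto
  then show ?thesis using assms by (simp add: norm_mult norm_power)
qed

lemma qpoch_nonzero:
  assumes "norm a < 1" "norm q < 1"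
  shows "qpoch a q n \<noteq> 0"
  using norm_mult_power_less_one[OF assms] by (metis norm_one order_less_irrefl qpoch_eq_0_iff)

lemma convergent_prod_qpoch:
  fixes a q :: complex
  assumes "norm a < 1" "norm q < 1"
  shows "convergent_prod (\<lambda>k. 1 - a * q ^ k)"
proof -
  have "summable (\<lambda>k. norm (- (a * q ^ k)))"
    using assms by (simp add: norm_mult norm_power summable_mult summable_geometric)
  moreover have "- (a * q ^ k) \<noteq> - 1" for k
    using norm_mult_power_less_one[OF assms, of k] by auto
  ultimately show ?thesis
    using summable_imp_convergent_prod_complex[of "\<lambda>k. - (a * q ^ k)"] by simp
qed

lemma qpoch_tendsto:
  assumes "norm a < 1" "norm q < 1"
  shows "qpoch a q \<longlonglongrightarrow> qpoch_inf a q"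
  using convergent_prod_LIMSEQ[OF convergent_prod_qpoch[OF assms]]
  unfolding qpoch_def[abs_def] qpoch_inf_def by (simp add: LIMSEQ_lessThan_iff_atMost)

lemma qpoch_inf_nonzero:
  assumes "norm a < 1" "norm q < 1"
  shows "qpoch_inf a q \<noteq> 0"
  unfolding qpoch_inf_def
  using norm_mult_power_less_one[OF assms]
  by (intro prodinf_nonzero convergent_prod_qpoch assms) (metis norm_one order_less_irrefl right_minus_eq)

lemma Bseq_qpoch: "norm a < 1 \<Longrightarrow> norm q < 1 \<Longrightarrow> Bseq (qpoch a q)"
  using qpoch_tendsto convergentI convergent_imp_Bseq by blast

lemma Bseq_inverse_qpoch:
  assumes "norm a < 1" "norm q < 1"
  shows "Bseq (\<lambda>n. inverse (qpoch a q n))"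
  using tendsto_inverse[OF qpoch_tendsto[OF assms] qpoch_inf_nonzero[OF assms]]
  by (intro convergent_imp_Bseq convergentI)

text \<open>Factorwise difference of squares. It exhibits the denominator of the theorem as that of
  a basic hypergeometric series with lower parameter \<open>- p\<close>.\<close>

lemma qpoch_mult_minus: "qpoch p p n * qpoch (- p) p n = qpoch (p ^ 2) (p ^ 2) n"
  by (induction n) (simp_all add: qpoch_Suc algebra_simps power2_eq_square power_mult_distrib)

text \<open>The exponents from 1 to \<open>2 * n\<close> split into odd and even ones; the limit is
  one of the two ingredients of Euler's identity.\<close>

lemma qpoch_even_odd: "qpoch p p (2 * n) = qpoch p (p ^ 2) n * qpoch (p ^ 2) (p ^ 2) n"
proof (induction n)
  case (Suc n)
  have "p ^ (2 * n) = (p ^ n) ^ 2" "(p ^ 2) ^ n = (p ^ n) ^ 2"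
    by (simp_all add: power_mult[symmetric] mult.commute)
  with Suc show ?case
    by (simp add: qpoch_Suc algebra_simps power2_eq_square)
qed simp

lemma qpoch_add: "qpoch a q (m + n) = qpoch a q m * qpoch (a * q ^ m) q n"
  by (induction n) (simp_all add: qpoch_Suc power_add mult_ac)

lemma qpoch_inf_mult_minus:
  assumes "norm p < 1"
  shows "qpoch_inf p p * qpoch_inf (- p) p = qpoch_inf (p ^ 2) (p ^ 2)"
proof -
  have p2: "norm (p ^ 2) < 1" using assms by (simp add: norm_power power_less_one_iff)
  have "(\<lambda>n. qpoch p p n * qpoch (- p) p n) \<longlonglongrightarrow> qpoch_inf p p * qpoch_inf (- p) p"
    using assms by (intro tendsto_mult qpoch_tendsto) auto
  then show ?thesis unfolding qpoch_mult_minus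
    using qpoch_tendsto[OF p2 p2] LIMSEQ_unique by blast
qed

lemma qpoch_inf_even_odd:
  assumes "norm p < 1"
  shows "qpoch_inf p p = qpoch_inf p (p ^ 2) * qpoch_inf (p ^ 2) (p ^ 2)"
proof -
  have p2: "norm (p ^ 2) < 1" using assms by (simp add: norm_power power_less_one_iff)
  have "(\<lambda>n. qpoch p (p ^ 2) n * qpoch (p ^ 2) (p ^ 2) n)
      \<longlonglongrightarrow> qpoch_inf p (p ^ 2) * qpoch_inf (p ^ 2) (p ^ 2)"
    using assms p2 by (intro tendsto_mult qpoch_tendsto) auto
  moreover have "(\<lambda>n. qpoch p p (2 * n)) \<longlonglongrightarrow> qpoch_inf p p"
    using LIMSEQ_subseq_LIMSEQ[OF qpoch_tendsto[OF assms assms], of "\<lambda>n. 2 * n"]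
    by (simp add: strict_mono_def o_def)
  ultimately show ?thesis unfolding qpoch_even_odd using LIMSEQ_unique by blast
qed

subsection \<open>The Chebyshev product\<close>

text \<open>For \<open>x = (z + 1/z)/2\<close> this is \<open>(-zq;q^2)_n (-q/z;q^2)_n\<close>,
  written without \<open>z\<close> so that no root has to be chosen.\<close>

definition cheb_prod :: "complex \<Rightarrow> complex \<Rightarrow> nat \<Rightarrow> complex" where
  "cheb_prod x q n = (\<Prod>i = 1..n. 1 + 2 * x * q ^ (2 * i - 1) + q ^ (4 * i - 2))"

text \<open>At index \<open>Suc n\<close> the truncated subtractions in the exponents resolve, and
  the new factor becomes a quadratic polynomial in \<open>(q ^ 2) ^ n\<close>.\<close>

lemma cheb_prod_0 [simp]: "cheb_prod x q 0 = 1"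
  and cheb_prod_Suc: "cheb_prod x q (Suc n)
    = cheb_prod x q n * (1 + 2 * x * q * (q ^ 2) ^ n + q ^ 2 * ((q ^ 2) ^ n) ^ 2)"
proof -
  have "4 * Suc n - 2 = 2 + 2 * n * 2" by simp
  then have "q ^ (4 * Suc n - 2) = q ^ 2 * ((q ^ 2) ^ n) ^ 2"
    by (metis power_add power_mult)
  moreover have "q ^ (2 * Suc n - 1) = q * (q ^ 2) ^ n"
    by (simp add: power_mult)
  ultimately show "cheb_prod x q (Suc n)
    = cheb_prod x q n * (1 + 2 * x * q * (q ^ 2) ^ n + q ^ 2 * ((q ^ 2) ^ n) ^ 2)"
    by (simp add: cheb_prod_def mult.assoc del: mult_Suc_right)
qed (simp add: cheb_prod_def)

text \<open>Two geometric series dominate the deviations of the factors from 1. Only convergence is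
  claimed, since a factor, and with it the limit, may be 0.\<close>

lemma convergent_cheb_prod:
  assumes "norm q < 1"
  shows "convergent (cheb_prod x q)"
proof -
  have p: "norm (q ^ 2) < 1" using assms by (simp add: norm_power power_less_one_iff)
  have p': "norm ((q ^ 2) ^ 2) < 1" using p by (simp only: norm_power[of "q^2" 2]) (simp add: power_less_one_iff)
  define f where "f i = 2 * x * q * (q ^ 2) ^ i + q ^ 2 * ((q ^ 2) ^ 2) ^ i" for i
  have "summable (\<lambda>i. norm (f i))"
  proof (rule summable_comparison_test)
    show "\<exists>N. \<forall>i\<ge>N. norm (norm (f i))
        \<le> norm (2 * x * q) * norm (q ^ 2) ^ i + norm (q ^ 2) * norm ((q ^ 2) ^ 2) ^ i"
      unfolding f_def
      by (intro exI allI impI) (simp add: norm_triangle_le norm_mult norm_power)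
    show "summable (\<lambda>i. norm (2 * x * q) * norm (q ^ 2) ^ i + norm (q ^ 2) * norm ((q ^ 2) ^ 2) ^ i)"
      using p p' by (intro summable_add summable_mult summable_geometric) auto
  qed
  then have "convergent_prod (\<lambda>i. 1 + f i)"
    by (intro abs_convergent_prod_imp_convergent_prod summable_imp_abs_convergent_prod) simp
  then have "(\<lambda>n. \<Prod>i<n. 1 + f i) \<longlonglongrightarrow> prodinf (\<lambda>i. 1 + f i)"
    using convergent_prod_LIMSEQ by (metis LIMSEQ_lessThan_iff_atMost)
  moreover have "(\<Prod>i<n. 1 + f i) = cheb_prod x q n" for n
    by (induction n) (simp_all add: cheb_prod_Suc f_def power_mult[symmetric] mult.commute add.assoc)
  ultimately show ?thesis by (auto simp: convergent_def)
qed

subsection \<open>The finite Jacobi triple product in Chebyshev form\<close>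

definition cheb_W :: "complex \<Rightarrow> nat \<Rightarrow> complex" where
  "cheb_W x n = chebyshev_V (int n) x + chebyshev_V (int n - 1) x"

lemma cheb_W_0 [simp]: "cheb_W x 0 = 1"
  and cheb_W_1 [simp]: "cheb_W x (Suc 0) = 2 * x"
  by (simp_all add: cheb_W_def chebyshev_V_def)

text \<open>For \<open>x = cos \<theta>\<close> one has \<open>cheb_W x n = 2 cos (n \<theta>)\<close> when \<open>n > 0\<close>, but
  \<open>cheb_W x 0 = 1\<close>; hence the exceptional value in the recurrence.\<close>

lemma cheb_W_Suc_Suc:
  "cheb_W x (Suc (Suc n)) = 2 * x * cheb_W x (Suc n) - (if n = 0 then 2 else cheb_W x n)"
proof (cases n)
  case (Suc m)
  have "nat (int (Suc k) - 1) = k" "\<not> int (Suc k) - 1 < 0" for k by simp_all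
  then have "cheb_W x (Suc k) = chebyshev_V_nat (Suc k) x + chebyshev_V_nat k x" for k
    unfolding cheb_W_def chebyshev_V_def by (simp only: nat_int if_False of_nat_less_0_iff)
  with Suc show ?thesis by (simp add: algebra_simps)
qed (simp add: cheb_W_def chebyshev_V_def algebra_simps numeral_2_eq_2)

text \<open>The recurrence preserves parity. This trades the signs of the theta series for the
  change from \<open>x\<close> to \<open>- x\<close> that the q-Gauss sum produces.\<close>

lemma cheb_W_minus: "cheb_W (- x) n = (- 1) ^ n * cheb_W x n"
proof (induction n rule: less_induct)
  case (less n)
  consider "n = 0" | "n = 1" | m where "n = Suc (Suc m)"
    by (metis One_nat_def not0_implies_Suc)
  then show ?case
  proof cases
    case 3
    then show ?thesis using less[of m] less[of "Suc m"]
      by (simp add: cheb_W_Suc_Suc algebra_simps)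
  qed simp_all
qed

text \<open>A crude geometric bound suffices, because \<open>q ^ (k ^ 2)\<close> beats any geometric
  growth. The factor 2 covers the exceptional value in the recurrence.\<close>

lemma norm_cheb_W_le: "norm (cheb_W x n) \<le> 2 * (2 * norm x + 1) ^ n"
proof (induction n rule: less_induct)
  case (less n)
  define R where "R = 2 * norm x + 1"
  have R: "R \<ge> 1" by (simp add: R_def)
  consider "n = 0" | "n = 1" | m where "n = Suc (Suc m)"
    by (metis One_nat_def not0_implies_Suc)
  then show ?case
  proof cases
    case 3
    have "norm (if m = 0 then 2 else cheb_W x m) \<le> 2 * R ^ m"
      using less[of m] 3 by (auto simp: R_def)
    also have "\<dots> \<le> 2 * R ^ Suc m" using R by simp
    finally have 1: "norm (if m = 0 then 2 else cheb_W x m) \<le> 2 * R ^ Suc m" .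
    have "norm (2 * x * cheb_W x (Suc m)) \<le> 2 * norm x * (2 * R ^ Suc m)"
      using less[of "Suc m"] 3 unfolding norm_mult R_def by (intro mult_mono) auto
    then have "norm (cheb_W x n) \<le> 2 * norm x * (2 * R ^ Suc m) + 2 * R ^ Suc m"
      using 1 unfolding 3 cheb_W_Suc_Suc by (meson add_mono norm_triangle_ineq4 order_trans)
    also have "\<dots> = 2 * R ^ n"
      unfolding 3 by (simp add: R_def algebra_simps)
    finally show ?thesis by (simp add: R_def)
  qed (simp_all add: norm_mult)
qed

text \<open>The three-term recurrence moves multiplication by \<open>2 * x\<close> onto the
  coefficients. The term \<open>2 * b 1\<close> reflects the exceptional value at index 0; the last
  two terms are boundary terms, absent if \<open>b\<close> vanishes beyond \<open>n\<close>.\<close>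

lemma cheb_W_sum_mult:
  "2 * x * (\<Sum>k\<le>n. cheb_W x k * b k) = 2 * b 1 + (\<Sum>k\<le>n. cheb_W x (Suc k) * (b k + b (Suc (Suc k))))
     - (if n = 0 then 2 else cheb_W x n) * b (Suc n) - cheb_W x (Suc n) * b (Suc (Suc n))"
proof (induction n)
  case (Suc n)
  then show ?case
    by (simp add: cheb_W_Suc_Suc[of x n] cheb_W_Suc_Suc[of x "Suc n"] algebra_simps split: if_splits)
qed (simp add: algebra_simps)

text \<open>The q-binomial coefficient \<open>[2n choose n + k]\<close> with base \<open>p\<close>.\<close>

definition central_qbinom :: "complex \<Rightarrow> nat \<Rightarrow> nat \<Rightarrow> complex" where
  "central_qbinom p n k =
     (if k \<le> n then qpoch p p (2 * n) / (qpoch p p (n - k) * qpoch p p (n + k)) else 0)"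

section \<open>Recurrences, limit and bound for the central q-binomial coefficients\<close>

context
  fixes p :: complex
  assumes p: "norm p < 1"
begin

lemma one_minus_power_nonzero: "1 - p * p ^ n \<noteq> 0"
  using norm_mult_power_less_one[OF p p, of n] by auto

lemma central_qbinom_Suc_right:
  assumes "k \<le> n"
  shows "central_qbinom p n (Suc k) = central_qbinom p n k * (1 - p ^ (n - k)) / (1 - p * p ^ (n + k))"
proof (cases "k = n")
  case False
  then obtain m where m: "n = Suc (k + m)"
    using assms by (metis le_neq_implies_less less_imp_Suc_add)
  have "n - k = Suc m" "n - Suc k = m" "Suc k \<le> n" using m by auto
  then show ?thesis
    using one_minus_power_nonzero[of m] one_minus_power_nonzero[of "n + k"] qpoch_nonzero[OF p p]
    by (simp add: central_qbinom_def qpoch_Suc divide_simps)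
qed (simp add: central_qbinom_def)

text \<open>Along the diagonal \<open>n - k\<close> is constant, so only the factorials of lengths
  \<open>2 * n\<close> and \<open>n + k\<close> gain two factors each.\<close>

lemma central_qbinom_Suc_Suc:
  assumes "k \<le> n"
  shows "central_qbinom p (Suc n) (Suc k) = central_qbinom p n k * (1 - p * p ^ (2 * n)) * (1 - p ^ 2 * p ^ (2 * n))
     / ((1 - p * p ^ (n + k)) * (1 - p ^ 2 * p ^ (n + k)))"
  using assms one_minus_power_nonzero[of "n + k"] one_minus_power_nonzero[of "Suc (n + k)"] qpoch_nonzero[OF p p]
  by (simp add: central_qbinom_def qpoch_Suc divide_simps power2_eq_square mult.assoc)

text \<open>The case \<open>k = -1\<close> of the general recurrence below: the coefficients at -1
  and 1 agree by symmetry, whence the factor 2.\<close>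

lemma central_qbinom_Suc_0:
  "central_qbinom p (Suc n) 0 = central_qbinom p n 0 * (1 + p * p ^ (2 * n)) + 2 * p * p ^ n * central_qbinom p n 1"
proof -
  define u where "u = p ^ n"
  have u: "p ^ (2 * n) = u ^ 2" by (simp add: u_def power_mult[symmetric] mult.commute)
  have nz: "1 - p * u \<noteq> 0" using one_minus_power_nonzero[of n] by (simp add: u_def)
  have 1: "central_qbinom p (Suc n) 0
     = central_qbinom p n 0 * (1 - p * u ^ 2) * (1 - p ^ 2 * u ^ 2) / (1 - p * u) ^ 2"
    using nz qpoch_nonzero[OF p p]
    by (simp add: central_qbinom_def qpoch_Suc u power2_eq_square divide_simps flip: u_def)
  have 2: "central_qbinom p n 1 = central_qbinom p n 0 * (1 - u) / (1 - p * u)"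
    using central_qbinom_Suc_right[of 0 n] by (simp add: u_def)
  have "(1 - p * u ^ 2) * (1 - p ^ 2 * u ^ 2) / (1 - p * u) ^ 2
      = (1 + p * u ^ 2) + 2 * p * u * ((1 - u) / (1 - p * u))"
    using nz by (simp add: divide_simps) algebra
  from arg_cong[OF this, of "\<lambda>z. central_qbinom p n 0 * z"] show ?thesis
    unfolding 1 2 u unfolding u_def[symmetric] by (simp add: distrib_left mult_ac)
qed

text \<open>Two q-Pascal steps combined. After division by \<open>central_qbinom p n k\<close> every
  term is rational in \<open>p\<close>, \<open>c\<close> and \<open>b\<close>, where
  \<open>p ^ (2 * n) = c * b\<close>. The case \<open>k = n\<close> is separate because
  \<open>n - Suc k\<close> would truncate; there only the middle term survives.\<close>

lemma central_qbinom_rec: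
  assumes "k \<le> n"
  shows "central_qbinom p (Suc n) (Suc k) = central_qbinom p n (Suc k) * (1 + p * p ^ (2 * n))
     + p ^ (n - k) * central_qbinom p n k + p ^ (n + k + 2) * central_qbinom p n (Suc (Suc k))"
proof (cases "k = n")
  case True
  have "1 - p * p ^ (2 * n) \<noteq> 0" "1 - p ^ 2 * p ^ (2 * n) \<noteq> 0"
    using one_minus_power_nonzero[of "2 * n"] one_minus_power_nonzero[of "Suc (2 * n)"]
    by (simp_all add: power2_eq_square mult_ac)
  then show ?thesis using True qpoch_nonzero[OF p p]
    unfolding central_qbinom_Suc_Suc[OF assms] by (simp add: central_qbinom_def mult_2[symmetric])
next
  case False
  then have k: "Suc k \<le> n" using assms by simp
  define c where "c = p ^ (n - Suc k)"
  define b where "b = p * p ^ (n + k)"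
  have "n - k = Suc (n - Suc k)" using k by simp
  then have c1: "p ^ (n - k) = p * c" by (simp add: c_def)
  have "2 * n = (n - Suc k) + Suc (n + k)" using k by simp
  then have cb: "p ^ (2 * n) = c * b" unfolding c_def b_def by (metis power_add power_Suc)
  have nz: "1 - b \<noteq> 0" "1 - p * b \<noteq> 0"
    using one_minus_power_nonzero[of "n + k"] one_minus_power_nonzero[of "Suc (n + k)"] by (simp_all add: b_def)
  have b2: "p ^ 2 * p ^ (n + k) = p * b" "p ^ (n + k + 2) = p * b" "p * p ^ (n + Suc k) = p * b"
    by (simp_all add: b_def power2_eq_square power_add)
  have 1: "central_qbinom p n (Suc k) = central_qbinom p n k * ((1 - p * c) / (1 - b))"
    using central_qbinom_Suc_right[OF assms] by (simp add: c1 b_def)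
  have 2: "central_qbinom p n (Suc (Suc k)) = central_qbinom p n k * ((1 - p * c) / (1 - b) * ((1 - c) / (1 - p * b)))"
    using central_qbinom_Suc_right[OF k] unfolding b2 1 by (simp add: c_def)
  have 3: "central_qbinom p (Suc n) (Suc k) = central_qbinom p n k * ((1 - p * (c * b)) * (1 - p ^ 2 * (c * b)) / ((1 - b) * (1 - p * b)))"
    using central_qbinom_Suc_Suc[OF assms] unfolding b2 cb by (simp add: b_def)
  have "(1 - p * (c * b)) * (1 - p ^ 2 * (c * b)) / ((1 - b) * (1 - p * b))
      = (1 - p * c) / (1 - b) * (1 + p * (c * b)) + p * c + p * b * ((1 - p * c) / (1 - b) * ((1 - c) / (1 - p * b)))"
    using nz by (simp add: divide_simps) algebra
  then show ?thesis unfolding 1 2 3 cb c1 b2 by (simp add: algebra_simps)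
qed

lemma central_qbinom_tendsto:
  "(\<lambda>n. central_qbinom p n k) \<longlonglongrightarrow> 1 / qpoch_inf p p"
proof -
  note lim = qpoch_tendsto[OF p p]
  have "(\<lambda>n. qpoch p p (2 * n)) \<longlonglongrightarrow> qpoch_inf p p"
    using LIMSEQ_subseq_LIMSEQ[OF lim, of "\<lambda>n. 2 * n"] by (simp add: strict_mono_def o_def)
  moreover have "(\<lambda>n. qpoch p p (n - k)) \<longlonglongrightarrow> qpoch_inf p p"
    by (rule LIMSEQ_offset[of _ k]) (simp add: lim)
  moreover have "(\<lambda>n. qpoch p p (n + k)) \<longlonglongrightarrow> qpoch_inf p p"
    by (rule LIMSEQ_ignore_initial_segment[OF lim])
  ultimately have "(\<lambda>n. qpoch p p (2 * n) / (qpoch p p (n - k) * qpoch p p (n + k)))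
      \<longlonglongrightarrow> qpoch_inf p p / (qpoch_inf p p * qpoch_inf p p)"
    using qpoch_inf_nonzero[OF p p] by (intro tendsto_intros) auto
  then have "(\<lambda>n. qpoch p p (2 * n) / (qpoch p p (n - k) * qpoch p p (n + k))) \<longlonglongrightarrow> 1 / qpoch_inf p p"
    using qpoch_inf_nonzero[OF p p] by simp
  then show ?thesis
    by (rule Lim_transform_eventually)
       (use eventually_ge_at_top[of k] in eventually_elim, simp add: central_qbinom_def)
qed

text \<open>Uniformity in both indices provides the dominating series for Tannery's theorem.\<close>

lemma central_qbinom_bounded: "\<exists>C. \<forall>n k. norm (central_qbinom p n k) \<le> C"
proof -
  obtain A where A: "\<And>n. norm (qpoch p p n) \<le> A" "A > 0"
    using Bseq_qpoch[OF p p] by (auto simp: Bseq_def)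
  obtain B where B: "\<And>n. norm (inverse (qpoch p p n)) \<le> B" "B > 0"
    using Bseq_inverse_qpoch[OF p p] by (auto simp: Bseq_def)
  have "norm (central_qbinom p n k) \<le> A * (B * B)" for n k
  proof (cases "k \<le> n")
    case True
    then have "norm (central_qbinom p n k) = norm (qpoch p p (2 * n))
        * (norm (inverse (qpoch p p (n - k))) * norm (inverse (qpoch p p (n + k))))"
      by (simp add: central_qbinom_def norm_mult norm_divide norm_inverse field_simps)
    also have "\<dots> \<le> A * (B * B)"
      using A B by (intro mult_mono mult_nonneg_nonneg norm_ge_zero) (auto intro: less_imp_le)
    finally show ?thesis .
  qed (use A B in \<open>simp add: central_qbinom_def\<close>)
  then show ?thesis by blast
qed

end

text \<open>In terms of \<open>z\<close> this is the finite triple product with the powers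
  \<open>z^k\<close> and \<open>z^(-k)\<close> paired. In the induction the new factor is
  \<open>1 + p * p ^ (2 * n) + 2 * x * q * p ^ n\<close>; its last part acts through
  \<open>cheb_W_sum_mult\<close>, and the coefficients then match
  \<open>central_qbinom_rec\<close>.\<close>

lemma cheb_prod_eq_sum:
  assumes q: "norm q < 1"
  shows "cheb_prod x q n = (\<Sum>k\<le>n. cheb_W x k * (q ^ (k ^ 2) * central_qbinom (q ^ 2) n k))"
proof (induction n)
  case 0
  show ?case by (simp add: central_qbinom_def)
next
  case (Suc n)
  define p where "p = q ^ 2"
  have p: "norm p < 1" using q by (simp add: p_def norm_power power_less_one_iff)
  define b where "b k = q ^ (k ^ 2) * central_qbinom p n k" for k
  define b' where "b' k = q ^ (k ^ 2) * central_qbinom p (Suc n) k" for k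
  \<comment> \<open>The default value 0 beyond \<open>n\<close> removes the boundary terms of
    \<open>cheb_W_sum_mult\<close>.\<close>
  have b_eq_0: "b (Suc n) = 0" "b (Suc (Suc n)) = 0"
    by (simp_all add: b_def central_qbinom_def)
  have b'0: "b' 0 = b 0 * (1 + p * p ^ (2 * n)) + 2 * q * p ^ n * b 1"
    unfolding b_def b'_def central_qbinom_Suc_0[OF p]
    by (simp add: p_def algebra_simps power2_eq_square)
  have b'Suc: "b' (Suc k) = b (Suc k) * (1 + p * p ^ (2 * n)) + q * p ^ n * (b k + b (Suc (Suc k)))"
    if "k \<le> n" for k
  proof -
    \<comment> \<open>Completing the square in the exponents: both outer terms of the recurrence
      acquire the common factor \<open>q * p ^ n\<close>.\<close>
    have "(Suc k) ^ 2 + 2 * (n - k) = 1 + 2 * n + k ^ 2"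
      using that by (simp add: power2_eq_square)
    from arg_cong[OF this, of "\<lambda>m. q ^ m"]
    have 1: "q ^ ((Suc k) ^ 2) * p ^ (n - k) = q * p ^ n * q ^ (k ^ 2)"
      by (simp only: power_add power_mult power_one_right p_def)
    have "(Suc k) ^ 2 + 2 * (n + k + 2) = 1 + 2 * n + (Suc (Suc k)) ^ 2"
      by (simp add: power2_eq_square)
    from arg_cong[OF this, of "\<lambda>m. q ^ m"]
    have 2: "q ^ ((Suc k) ^ 2) * p ^ (n + k + 2) = q * p ^ n * q ^ ((Suc (Suc k)) ^ 2)"
      by (simp only: power_add[of q] power_mult power_one_right p_def)
    have "b' (Suc k) = b (Suc k) * (1 + p * p ^ (2 * n))
       + (q ^ ((Suc k) ^ 2) * p ^ (n - k)) * central_qbinom p n k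
       + (q ^ ((Suc k) ^ 2) * p ^ (n + k + 2)) * central_qbinom p n (Suc (Suc k))"
      unfolding b_def b'_def central_qbinom_rec[OF p that] by (simp only: algebra_simps)
    then show ?thesis unfolding 1 2 b_def by (simp only: algebra_simps)
  qed
  have pw: "(p ^ n) ^ 2 = p ^ (2 * n)" by (simp add: power_mult[symmetric] mult.commute)
  have shift: "(\<Sum>k\<le>n. cheb_W x k * b k) = b 0 + (\<Sum>k\<le>n. cheb_W x (Suc k) * b (Suc k))"
    using sum.atMost_Suc_shift[of "\<lambda>k. cheb_W x k * b k" n] by (simp add: b_eq_0)
  have mult: "2 * x * (\<Sum>k\<le>n. cheb_W x k * b k)
      = 2 * b 1 + (\<Sum>k\<le>n. cheb_W x (Suc k) * (b k + b (Suc (Suc k))))"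
    using cheb_W_sum_mult[of x b n] by (simp add: b_eq_0)
  have "(\<Sum>k\<le>Suc n. cheb_W x k * b' k) = b' 0 + (\<Sum>k\<le>n. cheb_W x (Suc k) * b' (Suc k))"
    by (subst sum.atMost_Suc_shift) simp
  also have "(\<Sum>k\<le>n. cheb_W x (Suc k) * b' (Suc k))
      = (\<Sum>k\<le>n. (1 + p * p ^ (2 * n)) * (cheb_W x (Suc k) * b (Suc k))
          + q * p ^ n * (cheb_W x (Suc k) * (b k + b (Suc (Suc k)))))"
    by (intro sum.cong refl) (simp add: b'Suc algebra_simps)
  also have "\<dots> = (1 + p * p ^ (2 * n)) * (\<Sum>k\<le>n. cheb_W x (Suc k) * b (Suc k))
      + q * p ^ n * (\<Sum>k\<le>n. cheb_W x (Suc k) * (b k + b (Suc (Suc k))))"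
    by (simp only: sum.distrib sum_distrib_left)
  also have "b' 0 + \<dots> = (1 + p * p ^ (2 * n)) * (\<Sum>k\<le>n. cheb_W x k * b k)
      + q * p ^ n * (2 * x * (\<Sum>k\<le>n. cheb_W x k * b k))"
    unfolding mult unfolding shift b'0 by (simp add: algebra_simps)
  also have "\<dots> = cheb_prod x q (Suc n)"
    unfolding cheb_prod_Suc Suc p_def[symmetric] b_def[symmetric] pw by (simp add: algebra_simps)
  finally show ?case by (simp add: b'_def p_def)
qed

text \<open>The bound on \<open>cheb_W\<close> gives terms of size at most
  \<open>2 * (norm q ^ k * R) ^ k\<close>, whose base is eventually below
  \<open>1 / 2\<close>.\<close>

lemma summable_norm_cheb_theta:
  assumes q: "norm q < 1"
  shows "summable (\<lambda>k. norm (q ^ (k ^ 2) * cheb_W x k))"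
proof -
  define R where "R = 2 * norm x + 1"
  have R: "R \<ge> 1" by (simp add: R_def)
  have "(\<lambda>k. norm q ^ k * R) \<longlonglongrightarrow> 0 * R"
    using q by (intro tendsto_intros LIMSEQ_realpow_zero) auto
  then have "\<forall>\<^sub>F k in sequentially. norm q ^ k * R < 1 / 2"
    by (rule order_tendstoD) simp
  then have "\<forall>\<^sub>F k in sequentially. norm (norm (q ^ (k ^ 2) * cheb_W x k)) \<le> 2 * (1 / 2) ^ k"
  proof eventually_elim
    case (elim k)
    have "norm (q ^ (k ^ 2) * cheb_W x k) \<le> norm q ^ (k ^ 2) * (2 * R ^ k)"
      using norm_cheb_W_le[of x k] by (simp add: norm_mult norm_power R_def mult_left_mono)
    also have "\<dots> = 2 * (norm q ^ k * R) ^ k"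
      by (simp add: power_mult_distrib power2_eq_square power_mult)
    also have "\<dots> \<le> 2 * (1 / 2) ^ k"
      using elim R by (intro mult_left_mono power_mono) auto
    finally show ?case by simp
  qed
  then show ?thesis
    by (rule summable_comparison_test_ev) (intro summable_mult summable_geometric, simp)
qed

text \<open>The Jacobi triple product: Tannery's theorem allows the termwise limit in the finite
  form.\<close>

lemma cheb_prod_tendsto:
  assumes q: "norm q < 1"
  shows "cheb_prod x q \<longlonglongrightarrow> (\<Sum>k. q ^ (k ^ 2) * cheb_W x k) / qpoch_inf (q ^ 2) (q ^ 2)"
proof -
  define p where "p = q ^ 2"
  have p: "norm p < 1" using q by (simp add: p_def norm_power power_less_one_iff)
  obtain C where C: "\<And>n k. norm (central_qbinom p n k) \<le> C"
    using central_qbinom_bounded[OF p] by blast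
  define a where "a k n = q ^ (k ^ 2) * cheb_W x k * central_qbinom p n k" for k n
  have "((\<lambda>n. \<Sum>k. a k n) \<longlonglongrightarrow> (\<Sum>k. q ^ (k ^ 2) * cheb_W x k * (1 / qpoch_inf p p)))"
  proof (rule tannerys_theorem[THEN conjunct2, THEN conjunct2])
    show "(\<lambda>n. a k n) \<longlonglongrightarrow> q ^ (k ^ 2) * cheb_W x k * (1 / qpoch_inf p p)" for k
      unfolding a_def by (intro tendsto_mult tendsto_const central_qbinom_tendsto p)
    show "\<forall>\<^sub>F (k, n) in at_top \<times>\<^sub>F sequentially. norm (a k n) \<le> norm (q ^ (k ^ 2) * cheb_W x k) * C"
      unfolding a_def norm_mult[of _ "central_qbinom _ _ _"]
      by (intro always_eventually) (auto intro: mult_left_mono C)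
    show "summable (\<lambda>k. norm (q ^ (k ^ 2) * cheb_W x k) * C)"
      by (intro summable_mult2 summable_norm_cheb_theta q)
  qed simp
  moreover have "(\<Sum>k. a k n) = cheb_prod x q n" for n
  proof -
    \<comment> \<open>The series is finite because \<open>central_qbinom\<close> is 0 for
      \<open>k > n\<close>.\<close>
    have "(\<Sum>k. a k n) = (\<Sum>k\<le>n. a k n)"
      by (rule suminf_finite) (auto simp: a_def central_qbinom_def)
    then show ?thesis
      by (simp add: cheb_prod_eq_sum[OF q] a_def p_def mult_ac)
  qed
  ultimately show ?thesis
    using suminf_mult2[OF summable_norm_cancel[OF summable_norm_cheb_theta[OF q]]]
    by (simp add: p_def suminf_divide[OF summable_norm_cancel[OF summable_norm_cheb_theta[OF q]]])
qed

subsection \<open>The q-Gauss sum\<close>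

text \<open>The terms of the series \<open>\<^sub>2\<phi>\<^sub>1(a, b; c; p, c / (a b))\<close> with \<open>p = q\<^sup>2\<close>,
  \<open>a + b = - 2 x q\<close>, \<open>a b = p\<close> and \<open>c = - y p\<close>.\<close>

definition gauss_term :: "complex \<Rightarrow> complex \<Rightarrow> complex \<Rightarrow> nat \<Rightarrow> complex" where
  "gauss_term x q y n =
     cheb_prod x q n * (- y) ^ n / (qpoch (q ^ 2) (q ^ 2) n * qpoch (- y * q ^ 2) (q ^ 2) n)"

lemma gauss_term_0 [simp]: "gauss_term x q y 0 = 1"
  by (simp add: gauss_term_def)

section \<open>Telescoping in the lower parameter\<close>

context
  fixes q p :: complex
  assumes q: "norm q < 1" and p_def: "p = q ^ 2"
begin

lemma norm_p_less_one: "norm p < 1"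
  using q by (simp add: p_def norm_power power_less_one_iff)

lemma norm_minus_mult_p_less_one:
  assumes "norm y \<le> 1"
  shows "norm (- y * p) < 1"
proof -
  have "norm (- y * p) \<le> 1 * norm p"
    unfolding norm_mult using assms by (intro mult_right_mono) auto
  then show ?thesis using norm_p_less_one by simp
qed

text \<open>Replacing \<open>c\<close> by \<open>c * p\<close> means replacing \<open>y\<close> by
  \<open>y * p\<close>. All terms are multiples of \<open>gauss_term x q y n\<close> by rational
  functions of \<open>u = p ^ n\<close>, so a polynomial identity remains.\<close>

lemma gauss_term_telescope:
  assumes y: "norm y \<le> 1"
  shows "(1 + y) * gauss_term x q y n
       - (1 - 2 * x * q * y + p * y ^ 2) / (1 + y * p) * gauss_term x q (y * p) n
     = (1 - p ^ n) * gauss_term x q y n - (1 - p ^ Suc n) * gauss_term x q y (Suc n)"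
proof -
  note yp = norm_minus_mult_p_less_one[OF y]
  define u where "u = p ^ n"
  define P Q E where "P = cheb_prod x q n" and "Q = qpoch p p n" and "E = qpoch (- y * p) p n"
  have Q: "Q \<noteq> 0" using qpoch_nonzero[OF norm_p_less_one norm_p_less_one] by (simp add: Q_def)
  have E: "E \<noteq> 0" using qpoch_nonzero[OF yp norm_p_less_one] by (simp add: E_def)
  have nz: "1 + y * p * u \<noteq> 0" "1 + y * p \<noteq> 0" "1 - p * u \<noteq> 0"
    using norm_mult_power_less_one[OF yp norm_p_less_one, of n] yp
      norm_mult_power_less_one[OF norm_p_less_one norm_p_less_one, of n]
    by (auto simp: u_def add_eq_0_iff norm_minus_commute)
  have E': "qpoch (- (y * p) * p) p n = E * (1 + y * p * u) / (1 + y * p)"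
  proof -
    \<comment> \<open>Splitting off the first factor on one side and the last on the other shifts
      the base of the factorial.\<close>
    have "qpoch (- y * p) p (1 + n) = qpoch (- y * p) p (n + 1)" by (simp add: add.commute)
    then have "(1 + y * p) * qpoch (- (y * p) * p) p n = E * (1 + y * p * u)"
      unfolding qpoch_add by (simp add: qpoch_Suc E_def u_def)
    then show ?thesis using nz by (simp add: field_simps)
  qed
  define t where "t = gauss_term x q y n"
  have t: "t = P * (- y) ^ n / (Q * E)"
    by (simp add: t_def gauss_term_def P_def Q_def E_def p_def)
  have t1: "gauss_term x q (y * p) n = t * (u * (1 + y * p) / (1 + y * p * u))"
  proof -
    have "(- (y * p)) ^ n = (- y) ^ n * u"
      by (metis mult_minus_left power_mult_distrib u_def)
    then have "gauss_term x q (y * p) n = P * ((- y) ^ n * u) / (Q * (E * (1 + y * p * u) / (1 + y * p)))"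
      unfolding E'[symmetric] gauss_term_def P_def Q_def p_def[symmetric] by (simp only:)
    then show ?thesis unfolding t by (simp add: mult_ac)
  qed
  have t2: "gauss_term x q y (Suc n) = t * (- y * (1 + 2 * x * q * u + p * u ^ 2) / ((1 - p * u) * (1 + y * p * u)))"
    unfolding t P_def Q_def E_def u_def gauss_term_def cheb_prod_Suc qpoch_Suc p_def[symmetric]
    by (simp add: mult_ac)
  have "(1 + y) - (1 - 2 * x * q * y + p * y ^ 2) / (1 + y * p) * (u * (1 + y * p) / (1 + y * p * u))
     = (1 - u) - (1 - p * u) * (- y * (1 + 2 * x * q * u + p * u ^ 2) / ((1 - p * u) * (1 + y * p * u)))"
    using nz by (simp add: divide_simps) algebra
  from arg_cong[OF this, of "\<lambda>z. t * z"] show ?thesis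
    unfolding t1 t2 t_def[symmetric] u_def[symmetric] power_Suc
    by (simp only: right_diff_distrib mult_ac)
qed

text \<open>The lower boundary term carries \<open>1 - p ^ 0 = 0\<close>. The identity is exact for
  finite \<open>M\<close>, so it serves the convergent sums as well as the divergent case
  \<open>y = 1\<close>.\<close>

lemma gauss_term_sum:
  assumes "norm y \<le> 1"
  shows "(1 + y) * (\<Sum>n<M. gauss_term x q y n)
     = (1 - 2 * x * q * y + p * y ^ 2) / (1 + y * p) * (\<Sum>n<M. gauss_term x q (y * p) n)
       - (1 - p ^ M) * gauss_term x q y M"
proof (induction M)
  case (Suc M)
  then show ?case using gauss_term_telescope[OF assms, of x M]
    by (simp only: sum.lessThan_Suc distrib_left) (simp add: algebra_simps)
qed simp

text \<open>The factorial with shifted base is a quotient of two factorials with base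
  \<open>- p\<close>, which are bounded above and away from 0; hence \<open>C\<close> is independent
  of \<open>N\<close>.\<close>

lemma gauss_term_bound:
  "\<exists>C. \<forall>N n. norm (gauss_term x q (p ^ N) n) \<le> C * (norm p ^ N) ^ n"
proof -
  note p1 = norm_p_less_one
  have mp: "norm (- p) < 1" using p1 by simp
  obtain A where A: "\<And>n. norm (cheb_prod x q n) \<le> A" "A > 0"
    using convergent_imp_Bseq[OF convergent_cheb_prod[OF q]] by (auto simp: Bseq_def)
  obtain B where B: "\<And>n. norm (inverse (qpoch p p n)) \<le> B" "B > 0"
    using Bseq_inverse_qpoch[OF p1 p1] by (auto simp: Bseq_def)
  obtain D where D: "\<And>n. norm (qpoch (- p) p n) \<le> D" "D > 0"
    using Bseq_qpoch[OF mp p1] by (auto simp: Bseq_def)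
  obtain E where E: "\<And>n. norm (inverse (qpoch (- p) p n)) \<le> E" "E > 0"
    using Bseq_inverse_qpoch[OF mp p1] by (auto simp: Bseq_def)
  have "norm (gauss_term x q (p ^ N) n) \<le> A * (B * (D * E)) * (norm p ^ N) ^ n" for N n
  proof -
    have "qpoch (- p) p (N + n) = qpoch (- p) p N * qpoch (- (p ^ N) * p) p n"
      unfolding qpoch_add by (simp add: mult.commute)
    then have "inverse (qpoch (- (p ^ N) * p) p n) = qpoch (- p) p N * inverse (qpoch (- p) p (N + n))"
      using qpoch_nonzero[OF mp p1] by (simp add: field_simps)
    then have "gauss_term x q (p ^ N) n = cheb_prod x q n * (inverse (qpoch p p n)
        * (qpoch (- p) p N * inverse (qpoch (- p) p (N + n)))) * (- (p ^ N)) ^ n"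
      unfolding gauss_term_def p_def[symmetric] divide_inverse inverse_mult_distrib by (simp only: mult_ac)
    then have "norm (gauss_term x q (p ^ N) n) = norm (cheb_prod x q n) * (norm (inverse (qpoch p p n))
        * (norm (qpoch (- p) p N) * norm (inverse (qpoch (- p) p (N + n))))) * (norm p ^ N) ^ n"
      by (simp only: norm_mult norm_power norm_minus_cancel)
    also have "\<dots> \<le> A * (B * (D * E)) * (norm p ^ N) ^ n"
      using A B D E by (intro mult_mono mult_nonneg_nonneg norm_ge_zero zero_le_power order_refl)
        (auto intro: less_imp_le)
    finally show ?thesis .
  qed
  then show ?thesis by blast
qed

section \<open>The convergent sums at \<open>y = p ^ Suc N\<close> and their iteration\<close>

lemma summable_norm_gauss_term: "summable (\<lambda>n. norm (gauss_term x q (p ^ Suc N) n))"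
proof -
  obtain C where C: "\<And>N n. norm (gauss_term x q (p ^ N) n) \<le> C * (norm p ^ N) ^ n"
    using gauss_term_bound by blast
  have "norm p ^ Suc N < 1"
    using norm_p_less_one by (simp add: power_less_one_iff del: power_Suc)
  then have "summable (\<lambda>n. C * (norm p ^ Suc N) ^ n)"
    by (intro summable_mult summable_geometric) simp
  then show ?thesis
    by (rule summable_comparison_test') (simp only: real_norm_def abs_norm_cancel C)
qed

lemma gauss_term_tendsto_zero: "gauss_term x q (p ^ Suc N) \<longlonglongrightarrow> 0"
  using summable_LIMSEQ_zero[OF summable_norm_gauss_term] tendsto_norm_zero_cancel by blast

text \<open>Here the boundary term of \<open>gauss_term_sum\<close> tends to 0, so the finite
  identity passes to the infinite sums.\<close>

lemma suminf_gauss_term_step: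
  "(1 + p ^ Suc N) * (1 + p ^ Suc (Suc N)) * (\<Sum>n. gauss_term x q (p ^ Suc N) n)
   = (1 - 2 * x * q * p ^ Suc N + p * (p ^ Suc N) ^ 2) * (\<Sum>n. gauss_term x q (p ^ Suc (Suc N)) n)"
proof -
  define y where "y = p ^ Suc N"
  have y: "norm y \<le> 1" using norm_p_less_one unfolding y_def norm_power by (intro power_le_one) auto
  have yp: "y * p = p ^ Suc (Suc N)" by (simp add: y_def mult.commute)
  have nz: "1 + y * p \<noteq> 0"
    using norm_minus_mult_p_less_one[OF y] by (auto simp: add_eq_0_iff)
  note sums = summable_norm_cancel[OF summable_norm_gauss_term, THEN summable_LIMSEQ]
  have "(\<lambda>M. (1 + y) * (\<Sum>n<M. gauss_term x q y n)) \<longlonglongrightarrow> (1 + y) * (\<Sum>n. gauss_term x q y n)"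
    unfolding y_def by (intro tendsto_mult tendsto_const sums)
  moreover have "(\<lambda>M. (1 + y) * (\<Sum>n<M. gauss_term x q y n))
     \<longlonglongrightarrow> (1 - 2 * x * q * y + p * y ^ 2) / (1 + y * p) * (\<Sum>n. gauss_term x q (y * p) n)
       - (1 - 0) * 0"
    unfolding gauss_term_sum[OF y]
    using sums[of x "Suc N"] gauss_term_tendsto_zero[of x N, folded y_def]
    by (intro tendsto_mult tendsto_diff tendsto_const LIMSEQ_power_zero norm_p_less_one)
       (simp_all only: yp flip: y_def)
  ultimately have "(1 + y) * (\<Sum>n. gauss_term x q y n)
     = (1 - 2 * x * q * y + p * y ^ 2) / (1 + y * p) * (\<Sum>n. gauss_term x q (y * p) n)"
    using LIMSEQ_unique by fastforce
  then show ?thesis using nz unfolding yp y_def[symmetric] by (simp add: field_simps)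
qed

text \<open>As \<open>y\<close> tends to 0 only the term \<open>n = 0\<close> survives; the uniform
  bound supplies the domination.\<close>

lemma suminf_gauss_term_tendsto_one: "(\<lambda>N. \<Sum>n. gauss_term x q (p ^ Suc N) n) \<longlonglongrightarrow> 1"
proof -
  note p1 = norm_p_less_one
  obtain C where C: "\<And>N n. norm (gauss_term x q (p ^ N) n) \<le> C * (norm p ^ N) ^ n"
    using gauss_term_bound by blast
  have C0: "C \<ge> 0" using norm_ge_zero order_trans C[of 0 0] by fastforce
  have "(\<lambda>N. \<Sum>n. gauss_term x q (p ^ Suc N) n) \<longlonglongrightarrow> (\<Sum>n. if n = 0 then 1 else 0)"
  proof (rule tannerys_theorem[THEN conjunct2, THEN conjunct2])
    show "(\<lambda>N. gauss_term x q (p ^ Suc N) n) \<longlonglongrightarrow> (if n = 0 then 1 else 0)" for n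
    proof (cases "n = 0")
      case False
      have "(\<lambda>N. C * (norm p ^ Suc N) ^ n) \<longlonglongrightarrow> C * 0 ^ n"
        using p1 by (intro tendsto_intros LIMSEQ_Suc[OF LIMSEQ_realpow_zero]) auto
      then have "(\<lambda>N. C * (norm p ^ Suc N) ^ n) \<longlonglongrightarrow> 0" 
        using False by (simp only: power_0_left if_False mult_zero_right)
      then have "(\<lambda>N. gauss_term x q (p ^ Suc N) n) \<longlonglongrightarrow> 0"
        by (rule Lim_null_comparison[rotated]) (intro always_eventually allI C)
      then show ?thesis using False by simp
    qed simp
    have "norm (gauss_term x q (p ^ Suc N) n) \<le> C * norm p ^ n" for n N
    proof -
      have "norm p ^ Suc N \<le> norm p ^ 1"
        using p1 by (intro power_decreasing) auto
      then have "C * (norm p ^ Suc N) ^ n \<le> C * norm p ^ n"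
        using C0 by (intro mult_left_mono power_mono) auto
      then show ?thesis using C[of "Suc N" n] by linarith
    qed
    then show "\<forall>\<^sub>F (n, N) in at_top \<times>\<^sub>F sequentially. norm (gauss_term x q (p ^ Suc N) n) \<le> C * norm p ^ n"
      by (intro always_eventually) auto
    show "summable (\<lambda>n. C * norm p ^ n)"
      using p1 by (intro summable_mult summable_geometric) simp
  qed simp
  also have "(\<Sum>n::nat. if n = 0 then 1 else 0 :: complex) = 1"
    using suminf_finite[of "{0::nat}" "\<lambda>n. if n = 0 then 1 else 0 :: complex"] by simp
  finally show ?thesis .
qed

text \<open>The left prefactor is that of the step from \<open>y = 1\<close> to
  \<open>y = p\<close>, without its factor \<open>1 + y = 2\<close>. Consecutive steps share factors
  \<open>1 + p ^ k\<close>, which explains the two lengths \<open>Suc N\<close> and \<open>N\<close>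
  in the denominator.\<close>

lemma suminf_gauss_term_iterate:
  "(1 - 2 * x * q + p) / (1 + p) * (\<Sum>n. gauss_term x q p n)
   = cheb_prod (- x) q (Suc N) * (\<Sum>n. gauss_term x q (p ^ Suc N) n)
     / (qpoch (- p) p (Suc N) * qpoch (- p) p N)"
proof (induction N)
  case 0
  show ?case by (simp add: cheb_prod_Suc qpoch_Suc p_def)
next
  case (Suc N)
  have mp: "norm (- p) < 1" using norm_p_less_one by simp
  define S where "S N = (\<Sum>n. gauss_term x q (p ^ Suc N) n)" for N
  define E where "E = qpoch (- p) p N"
  define a b where "a = 1 + p ^ Suc N" and "b = 1 + p ^ Suc (Suc N)"
  define c where "c = 1 - 2 * x * q * p ^ Suc N + p * (p ^ Suc N) ^ 2"
  have E1: "qpoch (- p) p (Suc N) = E * a" "qpoch (- p) p (Suc (Suc N)) = E * a * b"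
    by (simp_all add: E_def a_def b_def qpoch_Suc)
  have nz: "E \<noteq> 0" "a \<noteq> 0" "b \<noteq> 0"
    using qpoch_nonzero[OF mp norm_p_less_one, of N] qpoch_nonzero[OF mp norm_p_less_one, of "Suc (Suc N)"]
    unfolding E1 by (auto simp: E_def)
  have "cheb_prod (- x) q (Suc (Suc N)) = cheb_prod (- x) q (Suc N) * c"
    unfolding cheb_prod_Suc[of _ _ "Suc N"] c_def p_def by simp
  moreover have "a * b * S N = c * S (Suc N)"
    unfolding a_def b_def c_def S_def by (rule suminf_gauss_term_step)
  ultimately have "cheb_prod (- x) q (Suc (Suc N)) * S (Suc N) = cheb_prod (- x) q (Suc N) * (a * b * S N)"
    by simp
  then show ?case
    unfolding Suc E1 S_def[symmetric] E_def[symmetric] using nz by (simp add: field_simps)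
qed

text \<open>The left side of the iteration does not depend on \<open>N\<close>, so it equals the
  limit of the right side, which the triple product at \<open>- x\<close> evaluates.\<close>

lemma suminf_gauss_term:
  "(1 - 2 * x * q + p) / (1 + p) * (\<Sum>n. gauss_term x q p n)
   = (\<Sum>k. q ^ (k ^ 2) * cheb_W (- x) k) / qpoch_inf p p / qpoch_inf (- p) p ^ 2"
proof -
  have mp: "norm (- p) < 1" using norm_p_less_one by simp
  note lim = qpoch_tendsto[OF mp norm_p_less_one]
  have "(\<lambda>N. cheb_prod (- x) q (Suc N) * (\<Sum>n. gauss_term x q (p ^ Suc N) n)
     / (qpoch (- p) p (Suc N) * qpoch (- p) p N))
     \<longlonglongrightarrow> (\<Sum>k. q ^ (k ^ 2) * cheb_W (- x) k) / qpoch_inf p p * 1 / (qpoch_inf (- p) p * qpoch_inf (- p) p)"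
    unfolding p_def
    by (intro tendsto_divide tendsto_mult LIMSEQ_Suc[OF cheb_prod_tendsto[OF q]]
        suminf_gauss_term_tendsto_one[unfolded p_def] LIMSEQ_Suc[OF lim[unfolded p_def]] lim[unfolded p_def])
       (use qpoch_inf_nonzero[OF mp norm_p_less_one] in \<open>simp add: p_def\<close>)
  then show ?thesis
    unfolding suminf_gauss_term_iterate[symmetric] LIMSEQ_const_iff by (simp add: power2_eq_square)
qed

text \<open>At \<open>y = 1\<close> the boundary term of the telescoping sum does not vanish in the limit but
  alternates in sign, so that it is annihilated by the Cesaro means.\<close>

lemma cesaro_sums_gauss_term_one:
  "cesaro_sums (gauss_term x q 1) ((1 - 2 * x * q + p) / (1 + p) * (\<Sum>n. gauss_term x q p n) / 2)"
proof -
  note p1 = norm_p_less_one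
  have mp: "norm (- p) < 1" using p1 by simp
  define c where "c = (1 - 2 * x * q + p) / (1 + p)"
  \<comment> \<open>\<open>g\<close> is the boundary term stripped of its sign; unlike the boundary
    term itself it converges.\<close>
  define g where "g M = (1 - p ^ M) * (cheb_prod x q M / (qpoch p p M * qpoch (- p) p M))" for M
  obtain L where L: "cheb_prod x q \<longlonglongrightarrow> L"
    using convergent_cheb_prod[OF q] by (auto simp: convergent_def)
  have g: "g \<longlonglongrightarrow> (1 - 0) * (L / (qpoch_inf p p * qpoch_inf (- p) p))"
    unfolding g_def using qpoch_inf_nonzero[OF p1 p1] qpoch_inf_nonzero[OF mp p1]
    by (intro tendsto_intros LIMSEQ_power_zero p1 mp L qpoch_tendsto) auto
  have gt: "(1 - p ^ M) * gauss_term x q 1 M = (- 1) ^ M * g M" for M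
    by (simp add: gauss_term_def g_def p_def)
  have "(\<Sum>n\<le>k. gauss_term x q 1 n)
      = c * (\<Sum>n\<le>k. gauss_term x q p n) / 2 + (- 1) ^ k * (g (Suc k) / 2)" for k
  proof -
    \<comment> \<open>The boundary index is \<open>Suc k\<close>, and its extra sign cancels the
      minus in \<open>gauss_term_sum\<close>.\<close>
    have "2 * (\<Sum>n\<le>k. gauss_term x q 1 n)
        = c * (\<Sum>n\<le>k. gauss_term x q p n) + (- 1) ^ k * g (Suc k)"
      using gauss_term_sum[of 1 x "Suc k"] unfolding gt lessThan_Suc_atMost by (simp add: c_def)
    then show ?thesis by (simp add: field_simps)
  qed
  moreover have "(\<lambda>k. c * (\<Sum>n\<le>k. gauss_term x q p n) / 2) \<longlonglongrightarrow> c * (\<Sum>n. gauss_term x q p n) / 2"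
    using summable_LIMSEQ'[OF summable_norm_cancel[OF summable_norm_gauss_term[of x 0]]]
    by (intro tendsto_intros) auto
  moreover have "(\<lambda>k. g (Suc k) / 2) \<longlonglongrightarrow> (1 - 0) * (L / (qpoch_inf p p * qpoch_inf (- p) p)) / 2"
    by (intro tendsto_divide tendsto_const LIMSEQ_Suc[OF g]) simp
  ultimately show ?thesis unfolding c_def[symmetric] by (rule cesaro_sumsI_oscillating)
qed

section \<open>Translation into the stated series and prefactor\<close>

lemma gauss_term_one: "gauss_term x q 1 n = (- 1) ^ n * cheb_prod x q n / qpoch (p ^ 2) (p ^ 2) n"
  unfolding gauss_term_def p_def[symmetric] qpoch_mult_minus[symmetric] by (simp add: mult.commute)

text \<open>Inserting \<open>qpoch_inf_mult_minus\<close> into the even-odd splitting and cancelling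
  \<open>qpoch_inf p p\<close> yields Euler's identity, which is then solved for the
  quotient.\<close>

lemma qpoch_inf_quotient:
  "qpoch_inf p (p ^ 2) / qpoch_inf (p ^ 2) (p ^ 2) = 1 / (qpoch_inf p p * qpoch_inf (- p) p ^ 2)"
proof -
  note p1 = norm_p_less_one
  have mp: "norm (- p) < 1" using p1 by simp
  have "qpoch_inf p p = qpoch_inf p (p ^ 2) * (qpoch_inf p p * qpoch_inf (- p) p)"
    using qpoch_inf_even_odd[OF p1] unfolding qpoch_inf_mult_minus[OF p1] .
  then have "qpoch_inf p (p ^ 2) * qpoch_inf (- p) p = 1"
    using qpoch_inf_nonzero[OF p1 p1] by simp
  then show ?thesis
    unfolding qpoch_inf_mult_minus[OF p1, symmetric]
    using qpoch_inf_nonzero[OF p1 p1] qpoch_inf_nonzero[OF mp p1]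
    by (simp add: divide_simps power2_eq_square)
qed

end

theorem theorem5p3:
  fixes q x :: complex
  assumes "norm q < 1"
  shows "cesaro_summable
           (\<lambda>n. (- 1) ^ n * (\<Prod>i = 1..n. 1 + 2 * x * q ^ (2 * i - 1) + q ^ (4 * i - 2)) / qpoch (q ^ 4) (q ^ 4) n)
       \<and> summable
           (\<lambda>n. (- 1) ^ n * q ^ (n ^ 2) * (chebyshev_V (int n) x + chebyshev_V (int n - 1) x))
       \<and> 2 * cesaro_suminf
           (\<lambda>n. (- 1) ^ n * (\<Prod>i = 1..n. 1 + 2 * x * q ^ (2 * i - 1) + q ^ (4 * i - 2)) / qpoch (q ^ 4) (q ^ 4) n)
         = qpoch_inf (q ^ 2) (q ^ 4) / qpoch_inf (q ^ 4) (q ^ 4)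
           * (\<Sum>n. (- 1) ^ n * q ^ (n ^ 2) * (chebyshev_V (int n) x + chebyshev_V (int n - 1) x))"
proof -
  have q4: "q ^ 4 = (q ^ 2) ^ 2" by (simp flip: power_mult)
  have summand: "(\<lambda>n. (- 1) ^ n * (\<Prod>i = 1..n. 1 + 2 * x * q ^ (2 * i - 1) + q ^ (4 * i - 2)) / qpoch (q ^ 4) (q ^ 4) n)
      = gauss_term x q 1"
    unfolding q4 by (rule ext) (simp only: gauss_term_one[OF assms refl] cheb_prod_def)
  have theta: "(\<lambda>n. (- 1) ^ n * q ^ (n ^ 2) * (chebyshev_V (int n) x + chebyshev_V (int n - 1) x))
      = (\<lambda>n. q ^ (n ^ 2) * cheb_W (- x) n)"
    unfolding cheb_W_minus by (simp add: cheb_W_def mult_ac)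
  note ces = cesaro_sums_gauss_term_one[OF assms refl, of x]
  have "2 * cesaro_suminf (gauss_term x q 1)
      = qpoch_inf (q ^ 2) (q ^ 4) / qpoch_inf (q ^ 4) (q ^ 4) * (\<Sum>n. q ^ (n ^ 2) * cheb_W (- x) n)"
    unfolding cesaro_suminf_eqI[OF ces] suminf_gauss_term[OF assms refl] q4
      qpoch_inf_quotient[OF assms refl] by (simp add: field_simps)
  moreover have "cesaro_summable (gauss_term x q 1)"
    unfolding cesaro_summable_def using ces by blast
  ultimately show ?thesis
    unfolding summand theta using summable_norm_cancel[OF summable_norm_cheb_theta[OF assms]] by blast
qed

end
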